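(* Let $R$ be a commutative ring with unity, $Y\subseteq\mathrm{Spec}(R)$, $A$ a multiplicatively closed subset of $R$ and $I$ an ideal of $R$ with $A\cap I=\emptyset$. If $I$ is an $\mathcal{H}_Y$-ideal, then $I_A$ is an $\mathcal{H}_Y$-ideal. If $I$ is a strong $\mathcal{H}_Y$-ideal, then $I_A$ is a strong $\mathcal{H}_Y$-ideal.
   Context: $h_Y(S)=\{P\in Y: S\subseteq P\}$ for $S\subseteq R$, and $h_Y(a)=h_Y(\{a\})$. An ideal $I$ of $R$ is an $\mathcal{H}_Y$-ideal if $a\in I$, $b\in R$ and $h_Y(a)\subseteq h_Y(b)$ imply $b\in I$. It is a strong $\mathcal{H}_Y$-ideal if for every finite subset $F\subseteq I$ and every $b\in R$, $h_Y(F)\subseteq h_Y(b)$ implies $b\in I$. A multiplicatively closed subset contains $1$ and is closed under products. $I_A=\{r\in R: ra\in I\text{ for some }a\in A\}$, which is an ideal of $R$. *)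

theory Defs
  imports "HOL-Algebra.Ideal"
begin

definition Spec :: "('a, 'b) ring_scheme \<Rightarrow> 'a set set"
  where "Spec R = {P. primeideal P R}"

definition prime_hull :: "'a set set \<Rightarrow> 'a set \<Rightarrow> 'a set set"
  where "prime_hull Y S = {P \<in> Y. S \<subseteq> P}"

definition H_ideal :: "('a, 'b) ring_scheme \<Rightarrow> 'a set set \<Rightarrow> 'a set \<Rightarrow> bool"
  where "H_ideal R Y I \<longleftrightarrow> ideal I R \<and>
    (\<forall>a\<in>I. \<forall>b\<in>carrier R. prime_hull Y {a} \<subseteq> prime_hull Y {b} \<longrightarrow> b \<in> I)"

text \<open>The finite set \<open>F\<close> may be empty; then \<open>prime_hull Y F = Y\<close>.\<close>

definition strong_H_ideal :: "('a, 'b) ring_scheme \<Rightarrow> 'a set set \<Rightarrow> 'a set \<Rightarrow> bool"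
  where "strong_H_ideal R Y I \<longleftrightarrow> ideal I R \<and>
    (\<forall>F b. finite F \<and> F \<subseteq> I \<and> b \<in> carrier R \<and> prime_hull Y F \<subseteq> prime_hull Y {b} \<longrightarrow> b \<in> I)"

text \<open>The ideal \<open>I\<^sub>A\<close>, the contraction of the extension of \<open>I\<close> to the localization at \<open>A\<close>.\<close>

definition ideal_sat :: "('a, 'b) ring_scheme \<Rightarrow> 'a set \<Rightarrow> 'a set \<Rightarrow> 'a set"
  where "ideal_sat R I A = {r \<in> carrier R. \<exists>a\<in>A. r \<otimes>\<^bsub>R\<^esub> a \<in> I}"

end

theory Submission
  imports Defs
begin

text \<open>If \<open>F \<subseteq> I\<^sub>A\<close> is finite, then some single \<open>c \<in> A\<close> satisfies \<open>F c \<subseteq> I\<close>. A prime containing \<open>F c\<close>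
  contains \<open>c\<close> or \<open>F\<close>, so \<open>h\<^sub>Y(F) \<subseteq> h\<^sub>Y(b)\<close> gives \<open>h\<^sub>Y(F c) \<subseteq> h\<^sub>Y(b c)\<close>; hence \<open>b c \<in> I\<close>.\<close>

lemma prime_hull_mult_mono:
  fixes R (structure)
  assumes "Y \<subseteq> Spec R" and F: "F \<subseteq> carrier R" and b: "b \<in> carrier R" and c: "c \<in> carrier R"
    and hull: "prime_hull Y F \<subseteq> prime_hull Y {b}"
  shows "prime_hull Y ((\<lambda>x. x \<otimes> c) ` F) \<subseteq> prime_hull Y {b \<otimes> c}"
proof
  fix P assume "P \<in> prime_hull Y ((\<lambda>x. x \<otimes> c) ` F)"
  then have P: "P \<in> Y" and Fc: "\<And>x. x \<in> F \<Longrightarrow> x \<otimes> c \<in> P"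
    by (auto simp: prime_hull_def)
  interpret primeideal P R
    using P assms(1) by (auto simp: Spec_def)
  have "b \<otimes> c \<in> P"
  proof (cases "c \<in> P")
    case True
    then show ?thesis using b by (rule I_l_closed)
  next
    case False
    \<comment> \<open>Each product \<open>x \<otimes> c\<close> lies in the prime \<open>P\<close>
      and \<open>c\<close> does not, so primeness puts \<open>x\<close> in \<open>P\<close>.\<close>
    then have "F \<subseteq> P" using Fc F c I_prime by blast
    then have "b \<in> P" using P hull by (auto simp: prime_hull_def)
    then show ?thesis using c by (rule I_r_closed)
  qed
  then show "P \<in> prime_hull Y {b \<otimes> c}" using P by (simp add: prime_hull_def)
qed

lemma mem_ideal_satI:
  fixes R (structure)
  assumes "b \<in> carrier R" "c \<in> A" "b \<otimes> c \<in> I"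
  shows "b \<in> ideal_sat R I A"
  using assms by (auto simp: ideal_sat_def)

lemma ideal_sat_common_multiplier:
  fixes R (structure)
  assumes "cring R" "submonoid A R" "ideal I R"
    and "finite F" "F \<subseteq> ideal_sat R I A"
  shows "\<exists>c\<in>A. (\<lambda>x. x \<otimes> c) ` F \<subseteq> I"
  using assms(4,5)
proof (induction F rule: finite_induct)
  case empty
  \<comment> \<open>Any element of \<open>A\<close> would do here; \<open>\<one>\<close> is one, so
    \<open>A\<close> is nonempty.\<close>
  then show ?case using submonoid.one_closed[OF assms(2)] by auto
next
  case (insert x F)
  interpret cring R by fact
  interpret A: submonoid A R by fact
  interpret I: ideal I R by fact
  obtain c where c: "c \<in> A" "\<And>y. y \<in> F \<Longrightarrow> y \<otimes> c \<in> I"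
    using insert by auto
  obtain d where d: "d \<in> A" "x \<otimes> d \<in> I" and x: "x \<in> carrier R"
    using insert.prems by (auto simp: ideal_sat_def)
  have car: "c \<in> carrier R" "d \<in> carrier R" using c d A.subset by auto
  \<comment> \<open>The new multiplier is \<open>c \<otimes> d\<close>: the factor \<open>d\<close>
    handles \<open>x\<close>, the factor \<open>c\<close> handles the elements of \<open>F\<close>,
    and in each case the other factor is absorbed by \<open>I\<close>.\<close>
  have "y \<otimes> (c \<otimes> d) \<in> I" if "y \<in> insert x F" for y
  proof (cases "y = x")
    case True
    have "x \<otimes> (c \<otimes> d) = c \<otimes> (x \<otimes> d)" using x car by (simp add: m_lcomm)
    then show ?thesis using True I.I_l_closed[OF d(2) car(1)] by simp
  next
    case False
    then have y: "y \<in> F" using that by simp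
    then have "y \<in> carrier R" using insert.prems by (auto simp: ideal_sat_def)
    then have "y \<otimes> (c \<otimes> d) = y \<otimes> c \<otimes> d" using car by (simp add: m_assoc)
    then show ?thesis using I.I_r_closed[OF c(2)[OF y] car(2)] by simp
  qed
  then show ?case using A.m_closed[OF c(1) d(1)] by blast
qed

text \<open>Both \<open>H_ideal\<close> and \<open>strong_H_ideal\<close> include being an ideal, so
  this part of the conclusion is shared. Multiples keep the multiplier of the original element; sums
  need a common one.\<close>

lemma ideal_ideal_sat:
  fixes R (structure)
  assumes "cring R" "submonoid A R" "ideal I R"
  shows "ideal (ideal_sat R I A) R"
proof -
  interpret cring R by fact
  interpret A: submonoid A R by fact
  interpret I: ideal I R by fact
  have mult: "r \<otimes> x \<in> ideal_sat R I A" if x: "x \<in> ideal_sat R I A" and r: "r \<in> carrier R" for x r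
  proof -
    obtain c where c: "c \<in> A" "x \<otimes> c \<in> I" and xR: "x \<in> carrier R"
      using x by (auto simp: ideal_sat_def)
    have "r \<otimes> x \<otimes> c = r \<otimes> (x \<otimes> c)"
      using r xR c A.subset by (auto simp: m_assoc)
    then have "r \<otimes> x \<otimes> c \<in> I" using I.I_l_closed[OF c(2) r] by simp
    then show ?thesis using r xR c(1) by (intro mem_ideal_satI) auto
  qed
  have add: "x \<oplus> y \<in> ideal_sat R I A" if x: "x \<in> ideal_sat R I A" and y: "y \<in> ideal_sat R I A" for x y
  proof -
    \<comment> \<open>The summands may have different multipliers; taking \<open>F = {x, y}\<close>
      replaces them by a single \<open>c\<close>, after which distributivity applies.\<close>
    obtain c where c: "c \<in> A" "x \<otimes> c \<in> I" "y \<otimes> c \<in> I"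
      using ideal_sat_common_multiplier[OF assms, of "{x, y}"] x y by auto
    have xy: "x \<in> carrier R" "y \<in> carrier R" using x y by (auto simp: ideal_sat_def)
    have "(x \<oplus> y) \<otimes> c = x \<otimes> c \<oplus> y \<otimes> c"
      using xy c A.subset by (auto simp: l_distr)
    then have "(x \<oplus> y) \<otimes> c \<in> I" using I.a_closed[OF c(2,3)] by simp
    then show ?thesis using xy c(1) by (intro mem_ideal_satI) auto
  qed
  have sub: "ideal_sat R I A \<subseteq> carrier R" by (auto simp: ideal_sat_def)
  have zero: "\<zero> \<in> ideal_sat R I A"
    using A.one_closed by (intro mem_ideal_satI[of _ _ \<one>]) auto
  show ?thesis
  proof (rule idealI)
    show "ring R" by (rule ring_axioms)
    show "subgroup (ideal_sat R I A) (add_monoid R)"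
    proof (rule add.subgroupI)
      \<comment> \<open>Negation is multiplication by \<open>\<ominus> \<one>\<close>, so it is
        covered by \<open>mult\<close>.\<close>
      show "\<ominus> x \<in> ideal_sat R I A" if "x \<in> ideal_sat R I A" for x
        using mult[OF that, of "\<ominus> \<one>"] that sub by (auto simp: l_minus)
    qed (use sub zero add in auto)
    show "x \<otimes> r \<in> ideal_sat R I A" if "x \<in> ideal_sat R I A" "r \<in> carrier R" for x r
      using mult[OF that] that sub by (auto simp: m_comm)
  qed (rule mult)
qed

theorem proposition5p4:
  fixes R :: "('a, 'b) ring_scheme" and Y :: "'a set set" and A I :: "'a set"
  assumes "cring R"
    and "Y \<subseteq> Spec R"
    and "submonoid A R"
    and "ideal I R"
    and "A \<inter> I = {}"
  shows "(H_ideal R Y I \<longrightarrow> H_ideal R Y (ideal_sat R I A)) \<and>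
    (strong_H_ideal R Y I \<longrightarrow> strong_H_ideal R Y (ideal_sat R I A))"
proof -
  interpret cring R by fact
  have ideal: "ideal (ideal_sat R I A) R"
    using assms by (intro ideal_ideal_sat)
  \<comment> \<open>One transfer from \<open>ideal_sat R I A\<close> down to \<open>I\<close> serves
    both claims: the first uses it for singletons, the second for arbitrary finite \<open>F\<close>.
    Once the hypothesis on \<open>I\<close> yields \<open>b \<otimes> c \<in> I\<close>, the same
    \<open>c\<close> witnesses that \<open>b\<close> is in \<open>ideal_sat R I A\<close>.\<close>
  have key: "\<exists>c\<in>A. (\<lambda>x. x \<otimes>\<^bsub>R\<^esub> c) ` F \<subseteq> I \<and> b \<otimes>\<^bsub>R\<^esub> c \<in> carrier R \<and>
      prime_hull Y ((\<lambda>x. x \<otimes>\<^bsub>R\<^esub> c) ` F) \<subseteq> prime_hull Y {b \<otimes>\<^bsub>R\<^esub> c}"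
    if F: "finite F" "F \<subseteq> ideal_sat R I A" and b: "b \<in> carrier R"
      and hull: "prime_hull Y F \<subseteq> prime_hull Y {b}" for F b
  proof -
    obtain c where c: "c \<in> A" "(\<lambda>x. x \<otimes>\<^bsub>R\<^esub> c) ` F \<subseteq> I"
      using ideal_sat_common_multiplier[OF assms(1,3,4) F] by blast
    have cR: "c \<in> carrier R" using c submonoid.subset[OF assms(3)] by auto
    have "F \<subseteq> carrier R" using F(2) by (auto simp: ideal_sat_def)
    from prime_hull_mult_mono[OF assms(2) this b cR hull] show ?thesis
      using c b cR by (blast intro: m_closed)
  qed
  show ?thesis
  proof (intro conjI impI)
    assume H: "H_ideal R Y I"
    have "b \<in> ideal_sat R I A"
      if a: "a \<in> ideal_sat R I A" and b: "b \<in> carrier R"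
        and hull: "prime_hull Y {a} \<subseteq> prime_hull Y {b}" for a b
    proof -
      \<comment> \<open>This is \<open>key\<close> for \<open>F = {a}\<close>, whose image under
        multiplication by \<open>c\<close> is again a singleton, as \<open>H_ideal\<close>
        requires.\<close>
      obtain c where c: "c \<in> A" "a \<otimes>\<^bsub>R\<^esub> c \<in> I" "b \<otimes>\<^bsub>R\<^esub> c \<in> carrier R"
        "prime_hull Y {a \<otimes>\<^bsub>R\<^esub> c} \<subseteq> prime_hull Y {b \<otimes>\<^bsub>R\<^esub> c}"
        using key[OF _ _ b hull] a by force
      then have "b \<otimes>\<^bsub>R\<^esub> c \<in> I" using H unfolding H_ideal_def by blast
      with b c(1) show ?thesis by (rule mem_ideal_satI)
    qed
    with ideal show "H_ideal R Y (ideal_sat R I A)" unfolding H_ideal_def by blast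
  next
    assume H: "strong_H_ideal R Y I"
    have "b \<in> ideal_sat R I A"
      if F: "finite F" "F \<subseteq> ideal_sat R I A" and b: "b \<in> carrier R"
        and hull: "prime_hull Y F \<subseteq> prime_hull Y {b}" for F b
    proof -
      obtain c where c: "c \<in> A" "(\<lambda>x. x \<otimes>\<^bsub>R\<^esub> c) ` F \<subseteq> I" "b \<otimes>\<^bsub>R\<^esub> c \<in> carrier R"
        "prime_hull Y ((\<lambda>x. x \<otimes>\<^bsub>R\<^esub> c) ` F) \<subseteq> prime_hull Y {b \<otimes>\<^bsub>R\<^esub> c}"
        using key[OF F b hull] by blast
      \<comment> \<open>The strong property of \<open>I\<close> is applied to the image of
        \<open>F\<close>, which is again finite.\<close>
      then have "b \<otimes>\<^bsub>R\<^esub> c \<in> I"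
        using H finite_imageI[OF F(1), of "\<lambda>x. x \<otimes>\<^bsub>R\<^esub> c"] unfolding strong_H_ideal_def by metis
      with b c(1) show ?thesis by (rule mem_ideal_satI)
    qed
    then show "strong_H_ideal R Y (ideal_sat R I A)"
      unfolding strong_H_ideal_def by (intro conjI ideal allI impI; elim conjE)
  qed
qed

end
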